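(* Let $a\in(0,1)$ be fixed. Then, as $n\to\infty$, $$P_{2n}^T(2\lfloor an\rfloor)=-\frac{1}{\sqrt{\pi n^3a^3(1-a)}}+O\bigl(n^{-5/2}\bigr),$$ and consequently $$\lim_{n\to\infty}n^{3/2}P_{2n}^T(2\lfloor an\rfloor)=-\frac{1}{\sqrt{\pi a^3(1-a)}}.$$
   Context: A positive path of length $2n$ is a lattice path in $\mathbb{Z}^2$ starting at the origin with $2n$ steps, each $(1,1)$ or $(1,-1)$, that never goes below the line $Y=0$; a Dyck path is a positive path ending on $Y=0$. Let $T_{2n}=\binom{2n}{n}$ be the number of positive paths of length $2n$ and $D_{2n}=\frac{1}{n+1}\binom{2n}{n}$ the number of Dyck paths of length $2n$. For $0<N<n$, the pressure of positive paths of length $2n$ at the point $(2N,0)$ is the logarithm of the number of positive paths of length $2n$ avoiding $(2N,0)$ minus the logarithm of the number of all positive paths of length $2n$, that is, $$P_{2n}^T(2N)=\log\left(1-\frac{D_{2N}T_{2n-2N}}{T_{2n}}\right).$$ *)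

theory Defs
  imports Complex_Main "HOL-Library.Product_Plus" "HOL-Library.Landau_Symbols"
begin

text \<open>A lattice path starting at the origin is represented by the list of its steps in
  \<open>\<int>\<^sup>2\<close>; its \<open>k\<close>-th vertex is the sum of the first \<open>k\<close> steps.\<close>

definition vertex :: "(int \<times> int) list \<Rightarrow> nat \<Rightarrow> int \<times> int" where
  "vertex p k = sum_list (take k p)"

definition vertices :: "(int \<times> int) list \<Rightarrow> (int \<times> int) set" where
  "vertices p = vertex p ` {0..length p}"

definition positive_paths :: "nat \<Rightarrow> (int \<times> int) list set" where
  "positive_paths l =
     {p. length p = l \<and> set p \<subseteq> {(1, 1), (1, -1)} \<and> (\<forall>v\<in>vertices p. 0 \<le> snd v)}"

text \<open>The pressure of positive paths of length \<open>l\<close> at \<open>(m, 0)\<close>. It is meaningful for even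
  \<open>l\<close>, \<open>m\<close> with \<open>0 < m < l\<close>; at \<open>m = 0\<close> no path avoids the point and the value is an
  artefact of \<open>ln 0 = 0\<close>.\<close>

definition pressure :: "nat \<Rightarrow> nat \<Rightarrow> real" where
  "pressure l m =
     ln (real (card {p \<in> positive_paths l. (int m, 0) \<notin> vertices p}))
     - ln (real (card (positive_paths l)))"

end

theory Submission
  imports Defs "HOL-Analysis.Gamma_Function" "HOL-Real_Asymp.Real_Asymp"
begin

text \<open>Cutting a path at \<open>(2N, 0)\<close> into a Dyck path and a positive path gives
  \<open>pressure (2n) (2N) = ln (1 - r)\<close> with \<open>r = D\<^sub>2\<^sub>N T\<^sub>2\<^sub>n\<^sub>-\<^sub>2\<^sub>N / T\<^sub>2\<^sub>n\<close>. Wallis' product squeezes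
  \<open>\<pi> n (binom(2n, n) / 4\<^sup>n)\<^sup>2\<close> into \<open>[1 - 1/n, 1]\<close>, since \<open>n c\<^sub>n\<^sup>2\<close> increases and \<open>(n + 1/2) c\<^sub>n\<^sup>2\<close>
  decreases to \<open>1/\<pi>\<close> for \<open>c\<^sub>n = binom(2n, n) / 4\<^sup>n\<close>. With \<open>N = \<lfloor>an\<rfloor>\<close> this makes \<open>r\<close> equal to its
  leading term up to a factor \<open>1 + O(1/n)\<close>, and \<open>ln (1 - r) = -r + O(r\<^sup>2)\<close> with
  \<open>r\<^sup>2 = O(n\<^sup>-\<^sup>3)\<close>.\<close>

subsection \<open>Counting positive paths\<close>

text \<open>Height \<open>0\<close> gives the Dyck paths; the other heights are there because
  recursion on the last step leaves the axis.\<close>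

definition endpoint_paths :: "nat \<Rightarrow> int \<Rightarrow> (int \<times> int) list set" where
  "endpoint_paths l h = {p \<in> positive_paths l. snd (sum_list p) = h}"

lemma positive_paths_altdef:
  "positive_paths l = {p. length p = l \<and> set p \<subseteq> {(1, 1), (1, -1)} \<and>
     (\<forall>k\<le>l. 0 \<le> snd (sum_list (take k p)))}"
  by (auto simp: positive_paths_def vertices_def vertex_def)

lemma fst_sum_list_steps:
  "set p \<subseteq> {(1, 1), (1, -1)} \<Longrightarrow> fst (sum_list p) = int (length p)"
  by (induction p) auto

lemma finite_positive_paths [simp]: "finite (positive_paths l)"
proof (rule finite_subset)
  show "positive_paths l \<subseteq> {p. set p \<subseteq> {(1, 1), (1, -1)} \<and> length p = l}"
    by (auto simp: positive_paths_def)
qed (rule finite_lists_length_eq, simp)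

lemma finite_endpoint_paths [simp]: "finite (endpoint_paths l h)"
  by (rule finite_subset[OF _ finite_positive_paths]) (auto simp: endpoint_paths_def)

lemma positive_paths_0: "positive_paths 0 = {[]}"
  by (auto simp: positive_paths_altdef)

text \<open>The last step adds one vertex, hence one new height condition; both recursions on the
  last step rest on this.\<close>

lemma snoc_in_positive_paths_iff:
  "p @ [s] \<in> positive_paths (Suc l) \<longleftrightarrow>
     p \<in> positive_paths l \<and> s \<in> {(1, 1), (1, -1)} \<and> 0 \<le> snd (sum_list p) + snd s"
  by (auto simp: positive_paths_altdef le_Suc_eq all_conj_distrib)

text \<open>Since \<open>p\<close> ends on the axis, the heights along the second piece are those of
  \<open>q\<close> itself, so positivity splits at the cut.\<close>

lemma append_in_positive_paths_iff:
  assumes "length p = k" and "snd (sum_list p) = 0"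
  shows "p @ q \<in> positive_paths (k + l) \<longleftrightarrow> p \<in> positive_paths k \<and> q \<in> positive_paths l"
proof -
  have "(\<forall>j\<le>k + l. 0 \<le> snd (sum_list (take j (p @ q)))) \<longleftrightarrow>
     (\<forall>j\<le>k. 0 \<le> snd (sum_list (take j p))) \<and> (\<forall>j\<le>l. 0 \<le> snd (sum_list (take j q)))"
    (is "?L \<longleftrightarrow> ?R")
  proof
    assume L: ?L
    show ?R
    proof (intro conjI allI impI)
      fix j assume "j \<le> k"
      then show "0 \<le> snd (sum_list (take j p))" using L[rule_format, of j] assms by simp
    next
      fix j assume "j \<le> l"
      then show "0 \<le> snd (sum_list (take j q))" using L[rule_format, of "k + j"] assms by simp
    qed
  next
    assume R: ?R
    show ?L
    proof (intro allI impI)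
      fix j assume "j \<le> k + l"
      then show "0 \<le> snd (sum_list (take j (p @ q)))"
        using R[THEN conjunct1, rule_format, of j] R[THEN conjunct2, rule_format, of "j - k"] assms
        by (cases "j \<le> k") auto
    qed
  qed
  then show ?thesis
    using assms by (auto simp: positive_paths_altdef)
qed

lemma sum_list_nonneg_if_positive_path:
  "p \<in> positive_paths l \<Longrightarrow> 0 \<le> snd (sum_list p)"
  by (auto simp: positive_paths_altdef dest: spec[of _ l])

lemma endpoint_paths_neg: "h < 0 \<Longrightarrow> endpoint_paths l h = {}"
  using sum_list_nonneg_if_positive_path by (fastforce simp: endpoint_paths_def)

text \<open>Paths are sorted by their last step. At \<open>h = 0\<close> the first summand vanishes;
  at \<open>h = -1\<close> the second would count paths whose last step falls below the
  axis.\<close>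

lemma card_endpoint_paths_Suc:
  assumes "0 \<le> h"
  shows "card (endpoint_paths (Suc l) h) =
           card (endpoint_paths l (h - 1)) + card (endpoint_paths l (h + 1))"
proof -
  have "endpoint_paths (Suc l) h =
     (\<lambda>p. p @ [(1, 1)]) ` endpoint_paths l (h - 1) \<union> (\<lambda>p. p @ [(1, -1)]) ` endpoint_paths l (h + 1)"
    (is "?E = ?A \<union> ?B")
  proof
    show "?E \<subseteq> ?A \<union> ?B"
    proof
      fix p assume p: "p \<in> ?E"
      then have "length p = Suc l" by (simp add: endpoint_paths_def positive_paths_def)
      then obtain q s where "p = q @ [s]" by (cases p rule: rev_cases) auto
      with p show "p \<in> ?A \<union> ?B"
        by (auto simp: endpoint_paths_def snoc_in_positive_paths_iff)
    qed
    show "?A \<union> ?B \<subseteq> ?E"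
      using assms by (auto simp: endpoint_paths_def snoc_in_positive_paths_iff)
  qed
  moreover have "?A \<inter> ?B = {}" by auto
  ultimately show ?thesis
    by (simp add: card_Un_disjoint card_image inj_on_def)
qed

text \<open>Every path extends by both steps, except that one ending on the axis cannot go down. The
  additive form avoids subtraction on \<open>nat\<close>.\<close>

lemma card_positive_paths_Suc:
  "card (positive_paths (Suc l)) + card (endpoint_paths l 0) = 2 * card (positive_paths l)"
proof -
  let ?A = "(\<lambda>p. p @ [(1, 1)]) ` positive_paths l"
  let ?B = "(\<lambda>p. p @ [(1, -1)]) ` (positive_paths l - endpoint_paths l 0)"
  have "positive_paths (Suc l) = ?A \<union> ?B"
  proof
    show "positive_paths (Suc l) \<subseteq> ?A \<union> ?B"
    proof
      fix p assume p: "p \<in> positive_paths (Suc l)"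
      then have "length p = Suc l" by (simp add: positive_paths_def)
      then obtain q s where "p = q @ [s]" by (cases p rule: rev_cases) auto
      with p show "p \<in> ?A \<union> ?B"
        by (auto simp: endpoint_paths_def snoc_in_positive_paths_iff)
    qed
    show "?A \<union> ?B \<subseteq> positive_paths (Suc l)"
      using sum_list_nonneg_if_positive_path[of _ l]
      by (force simp: endpoint_paths_def snoc_in_positive_paths_iff)
  qed
  moreover have "?A \<inter> ?B = {}" by auto
  moreover have sub: "endpoint_paths l 0 \<subseteq> positive_paths l" by (auto simp: endpoint_paths_def)
  ultimately have "card (positive_paths (Suc l)) =
      card (positive_paths l) + (card (positive_paths l) - card (endpoint_paths l 0))"
    by (simp add: card_Un_disjoint card_image inj_on_def card_Diff_subset)
  then show ?thesis
    using card_mono[OF finite_positive_paths sub] by simp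
qed

text \<open>The ballot numbers, by up- and down-steps; the boundary case \<open>d = u + 1\<close>, where both
  sides vanish, is what makes the induction close.\<close>

lemma card_endpoint_paths:
  assumes "d \<le> u + 1"
  shows "real (u + 1) * real (card (endpoint_paths (u + d) (int u - int d))) =
           (real u + 1 - real d) * real ((u + d) choose d)"
  using assms
proof (induction "u + d" arbitrary: u d)
  case 0
  then have "endpoint_paths 0 0 = {[]}" by (auto simp: endpoint_paths_def positive_paths_0)
  with 0 show ?case by simp
next
  case (Suc l)
  consider "d = u + 1" | "d = 0" "u > 0" | "0 < d" "d \<le> u"
    using Suc by linarith
  then show ?case
  proof cases
    case 1
    then show ?thesis by (simp add: endpoint_paths_neg)
  next
    case 2
    then obtain v where u: "u = Suc v" by (cases u) auto
    \<comment> \<open>\<open>v\<close> steps climb at most to height \<open>v\<close>, so the all-up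
      path has only one predecessor in the recursion.\<close>
    have neq: "snd (sum_list p) \<noteq> 2 + int v" if "length p = v" "set p \<subseteq> {(1, 1), (1, -1)}" for p
    proof -
      from that(2) have "snd (sum_list p) \<le> int (length p)"
        by (induction p) auto
      with that show ?thesis by simp
    qed
    then have "endpoint_paths v (2 + int v) = {}"
      by (auto simp: endpoint_paths_def positive_paths_def)
    then have "card (endpoint_paths (Suc v) (1 + int v)) = card (endpoint_paths v (int v))"
      using card_endpoint_paths_Suc[of "1 + int v" v] by (simp add: add.commute)
    moreover have "card (endpoint_paths v (int v)) = 1"
      using Suc(1)[of v 0] Suc(2) 2 u by (simp add: add.commute)
    ultimately show ?thesis using 2 u by simp
  next
    case 3
    then obtain v e where ud: "u = Suc v" "d = Suc e" by (cases u; cases d) auto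
    define C where "C = real ((u + d) choose d)"
    have l: "l = v + d" "l = u + e" using Suc(2) ud by auto
    \<comment> \<open>Removing an up-step leads to \<open>(v, d)\<close>, removing a down-step to
      \<open>(u, e)\<close>. For \<open>d = u\<close> the first pair is the boundary case
      \<open>d = v + 1\<close>.\<close>
    have rec: "card (endpoint_paths (u + d) (int u - int d)) =
        card (endpoint_paths (v + d) (int v - int d)) + card (endpoint_paths (u + e) (int u - int e))"
      using card_endpoint_paths_Suc[of "int u - int d" l] 3 Suc(2) l ud
      by (simp add: algebra_simps)
    have IH1: "real u * real (card (endpoint_paths (v + d) (int v - int d))) =
        (real u - real d) * real ((v + d) choose d)"
      using Suc(1)[of v d] l 3 ud by (simp add: algebra_simps)
    have IH2: "(real u + 1) * real (card (endpoint_paths (u + e) (int u - int e))) =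
        (real u + 2 - real d) * real ((u + e) choose e)"
      using Suc(1)[of u e] l 3 ud by (simp add: algebra_simps)
    \<comment> \<open>Absorption and Pascal's rule express both smaller binomials as multiples of
      \<open>C\<close>, with common denominator \<open>u + d\<close>.\<close>
    have C2: "(real u + real d) * real ((u + e) choose e) = real d * C"
    proof -
      have "Suc e * (Suc (u + e) choose Suc e) = Suc (u + e) * ((u + e) choose e)"
        by (rule Suc_times_binomial)
      then have "real (Suc e * (Suc (u + e) choose Suc e)) = real (Suc (u + e) * ((u + e) choose e))"
        by (rule arg_cong)
      then show ?thesis
        unfolding C_def ud of_nat_mult by (simp add: algebra_simps)
    qed
    have "real ((u + e) choose e) + real ((v + d) choose d) = C"
      unfolding C_def ud by simp
    then have "(real u + real d) * real ((v + d) choose d) + real d * C = (real u + real d) * C"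
      unfolding C2[symmetric] by (metis add.commute distrib_left)
    then have C1: "(real u + real d) * real ((v + d) choose d) = real u * C"
      by (simp add: algebra_simps)
    define x y where "x = real (card (endpoint_paths (v + d) (int v - int d)))"
      and "y = real (card (endpoint_paths (u + e) (int u - int e)))"
    have "real u * ((real u + real d) * x) = real u * ((real u - real d) * C)"
      using IH1[folded x_def] C1 by algebra
    then have x: "(real u + real d) * x = (real u - real d) * C"
      using 3 by simp
    have y: "(real u + real d) * ((real u + 1) * y) = (real u + 2 - real d) * (real d * C)"
      using IH2[folded y_def] C2 by algebra
    \<comment> \<open>The underlying identity is
      \<open>(u - d)(u + 1) + (u + 2 - d) d = (u + d)(u + 1 - d)\<close>.\<close>
    have "(real u + real d) * ((real u + 1) * (x + y)) = (real u + real d) * ((real u + 1 - real d) * C)"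
      using x y by algebra
    then have "(real u + 1) * (x + y) = (real u + 1 - real d) * C"
      using 3 by simp
    then show ?thesis unfolding rec C_def x_def y_def of_nat_add of_nat_1 .
  qed
qed

section \<open>Catalan numbers and central binomial coefficients as path counts\<close>

lemma card_Dyck_paths:
  "real (n + 1) * real (card (endpoint_paths (2 * n) 0)) = real ((2 * n) choose n)"
  using card_endpoint_paths[of n n] by (simp add: mult_2)

text \<open>Each step flips the parity of the height, so after an odd number of steps no path is on
  the axis.\<close>

lemma endpoint_paths_odd:
  assumes "odd l"
  shows "endpoint_paths l 0 = {}"
proof -
  have "even (snd (sum_list p)) \<longleftrightarrow> even (length p)" if "set p \<subseteq> {(1, 1), (1, -1 :: int)}"
    for p :: "(int \<times> int) list"
    using that by (induction p) auto
  from this show ?thesis using assms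
    by (fastforce simp: endpoint_paths_def positive_paths_def)
qed

text \<open>Absorption is applied twice, with the symmetry of row \<open>2 * n + 1\<close> in
  between.\<close>

lemma central_binomial_Suc:
  "real (n + 1) * real ((2 * Suc n) choose Suc n) =
     2 * (2 * real n + 1) * real ((2 * n) choose n)"
proof -
  have "Suc n * ((2 * Suc n) choose Suc n) = Suc n * (2 * (Suc (2 * n) choose n))"
    using Suc_times_binomial[of n "Suc (2 * n)"] by simp
  then have "(2 * Suc n) choose Suc n = 2 * (Suc (2 * n) choose n)"
    by (simp only: mult_cancel1 nat.distinct simp_thms)
  also have "Suc (2 * n) choose n = Suc (2 * n) choose Suc n"
    using binomial_symmetric[of n "Suc (2 * n)"] by simp
  finally have "Suc n * ((2 * Suc n) choose Suc n) = 2 * (Suc n * (Suc (2 * n) choose Suc n))"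
    by simp
  also have "Suc n * (Suc (2 * n) choose Suc n) = Suc (2 * n) * ((2 * n) choose n)"
    by (rule Suc_times_binomial)
  finally have "real (Suc n * ((2 * Suc n) choose Suc n)) =
      real (2 * (Suc (2 * n) * ((2 * n) choose n)))"
    by (rule arg_cong)
  then show ?thesis
    unfolding of_nat_mult by (simp add: algebra_simps)
qed

text \<open>Two steps at once give \<open>T(2n+2) = 4 T(2n) - 2 D(2n)\<close>, as nothing is lost at
  odd length. The central binomials obey the same recursion because
  \<open>4 - 2/(n+1) = 2(2n+1)/(n+1)\<close>.\<close>

lemma card_positive_paths_even: "card (positive_paths (2 * n)) = (2 * n) choose n"
proof (induction n)
  case 0
  then show ?case by (simp add: positive_paths_0)
next
  case (Suc n)
  have "card (positive_paths (2 * Suc n)) + 2 * card (endpoint_paths (2 * n) 0) =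
      4 * ((2 * n) choose n)"
    using card_positive_paths_Suc[of "2 * n"] card_positive_paths_Suc[of "Suc (2 * n)"] Suc
      endpoint_paths_odd[of "Suc (2 * n)"] by simp
  then have "real (card (positive_paths (2 * Suc n))) + 2 * real (card (endpoint_paths (2 * n) 0)) =
      4 * real ((2 * n) choose n)"
    by linarith
  moreover have "(real n + 1) * real (card (endpoint_paths (2 * n) 0)) = real ((2 * n) choose n)"
    using card_Dyck_paths[of n] by (simp add: add.commute)
  moreover note central_binomial_Suc[of n, unfolded of_nat_add of_nat_1]
  ultimately have "(real n + 1) * real (card (positive_paths (2 * Suc n))) =
      (real n + 1) * real ((2 * Suc n) choose Suc n)"
    by algebra
  moreover have "real n + 1 \<noteq> 0"
    by linarith
  ultimately show ?case
    by (simp only: mult_cancel_left of_nat_eq_iff simp_thms)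
qed

text \<open>The first coordinate counts steps, so \<open>(m, 0)\<close> can only be visited at time
  \<open>m\<close>. Cutting there matches the paths through the point with pairs of a path ending on
  the axis and a positive path.\<close>

lemma card_avoiding_paths:
  assumes "m \<le> l"
  shows "card {p \<in> positive_paths l. (int m, 0) \<notin> vertices p} +
           card (endpoint_paths m 0) * card (positive_paths (l - m)) = card (positive_paths l)"
proof -
  let ?V = "{p \<in> positive_paths l. (int m, 0) \<in> vertices p}"
  have V: "(int m, 0) \<in> vertices p \<longleftrightarrow> snd (sum_list (take m p)) = 0" if p: "p \<in> positive_paths l" for p
  proof -
    have *: "fst (sum_list (take k p)) = int k" if "k \<le> l" for k
      using p that fst_sum_list_steps[of "take k p"] set_take_subset[of k p]
      by (auto simp: positive_paths_def)
    have len: "length p = l" using p by (simp add: positive_paths_def)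
    show ?thesis
    proof
      assume "(int m, 0) \<in> vertices p"
      then obtain k where k: "k \<le> l" "(int m, 0) = sum_list (take k p)"
        using len by (auto simp: vertices_def vertex_def)
      then have "k = m" using *[of k] by (metis fst_conv of_nat_eq_iff)
      with k show "snd (sum_list (take m p)) = 0" by (metis snd_conv)
    next
      assume "snd (sum_list (take m p)) = 0"
      then have "vertex p m = (int m, 0)"
        using *[of m] assms by (simp add: vertex_def prod_eq_iff)
      then show "(int m, 0) \<in> vertices p"
        using assms len by (auto simp: vertices_def intro!: rev_image_eqI[of m])
    qed
  qed
  have "bij_betw (\<lambda>(p, q). p @ q) (endpoint_paths m 0 \<times> positive_paths (l - m)) ?V"
    unfolding bij_betw_def
  proof
    show "inj_on (\<lambda>(p, q). p @ q) (endpoint_paths m 0 \<times> positive_paths (l - m))"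
      by (auto simp: inj_on_def endpoint_paths_def positive_paths_def)
    show "(\<lambda>(p, q). p @ q) ` (endpoint_paths m 0 \<times> positive_paths (l - m)) = ?V"
    proof
      show "(\<lambda>(p, q). p @ q) ` (endpoint_paths m 0 \<times> positive_paths (l - m)) \<subseteq> ?V"
      proof clarify
        fix p q assume pq: "p \<in> endpoint_paths m 0" "q \<in> positive_paths (l - m)"
        then have len: "length p = m" and "p @ q \<in> positive_paths l"
          using append_in_positive_paths_iff[of p m q "l - m"] assms
          by (auto simp: endpoint_paths_def positive_paths_def)
        moreover have "snd (sum_list (take m (p @ q))) = 0"
          using pq len by (simp add: endpoint_paths_def)
        ultimately show "p @ q \<in> positive_paths l \<and> (int m, 0) \<in> vertices (p @ q)"
          using V by blast
      qed
      show "?V \<subseteq> (\<lambda>(p, q). p @ q) ` (endpoint_paths m 0 \<times> positive_paths (l - m))"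
      proof
        fix p assume "p \<in> ?V"
        then have p: "p \<in> positive_paths l" "snd (sum_list (take m p)) = 0" using V by auto
        then have "take m p \<in> endpoint_paths m 0 \<and> drop m p \<in> positive_paths (l - m)"
          using append_in_positive_paths_iff[of "take m p" m "drop m p" "l - m"] assms
          by (auto simp: endpoint_paths_def positive_paths_def)
        then show "p \<in> (\<lambda>(p, q). p @ q) ` (endpoint_paths m 0 \<times> positive_paths (l - m))"
          by (intro rev_image_eqI[of "(take m p, drop m p)"]) auto
      qed
    qed
  qed
  then have "card (endpoint_paths m 0) * card (positive_paths (l - m)) = card ?V"
    using bij_betw_same_card by (fastforce simp: card_cartesian_product)
  moreover have "card {p \<in> positive_paths l. (int m, 0) \<notin> vertices p} + card ?V =
      card (positive_paths l)"
    by (subst card_Un_disjoint[symmetric]) (auto intro: arg_cong[of _ _ card])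
  ultimately show ?thesis by simp
qed

subsection \<open>Central binomial coefficients\<close>

text \<open>The probability that a simple random walk is at its origin after \<open>2 * n\<close>
  steps, asymptotically \<open>1 / sqrt (pi * n)\<close>. The normalising powers of 4 cancel in the
  ratio of path counts.\<close>

definition central_ratio :: "nat \<Rightarrow> real" where
  "central_ratio n = real ((2 * n) choose n) / 4 ^ n"

lemma central_ratio_pos: "central_ratio n > 0"
  by (simp add: central_ratio_def)

lemma central_ratio_Suc:
  "central_ratio (Suc n) = central_ratio n * ((2 * real n + 1) / (2 * real n + 2))"
proof -
  have "real ((2 * Suc n) choose Suc n) =
      2 * (2 * real n + 1) * real ((2 * n) choose n) / real (n + 1)"
    using central_binomial_Suc[of n] by (simp only: mult.commute eq_divide_eq) simp
  then show ?thesis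
    unfolding central_ratio_def by (simp only: power_Suc) (simp add: divide_simps, simp add: algebra_simps)
qed

text \<open>\<open>central_ratio n\<close> is the product of \<open>(2k-1)/(2k)\<close>, and the
  Wallis factors are \<open>(2k)(2k)/((2k-1)(2k+1))\<close>. This turns the Wallis limit into one
  for \<open>central_ratio n ^ 2\<close>.\<close>

lemma wallis_product_eq_central_ratio:
  "(\<Prod>k=1..n. (4 * real k ^ 2) / (4 * real k ^ 2 - 1)) = 1 / ((2 * real n + 1) * central_ratio n ^ 2)"
proof (induction n)
  case 0
  then show ?case by (simp add: central_ratio_def)
next
  case (Suc n)
  have "4 * real (Suc n) ^ 2 - 1 = (2 * real n + 1) * (2 * real n + 3)"
    by (simp add: power2_eq_square algebra_simps)
  moreover have "(\<Prod>k=1..Suc n. (4 * real k ^ 2) / (4 * real k ^ 2 - 1)) =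
      1 / ((2 * real n + 1) * central_ratio n ^ 2) * (4 * real (Suc n) ^ 2 / (4 * real (Suc n) ^ 2 - 1))"
    using Suc by simp
  moreover have "central_ratio (Suc n) = central_ratio n * ((2 * real n + 1) / (2 * (real n + 1)))"
    by (simp add: central_ratio_Suc)
  moreover have "2 * real n + 1 > 0" "2 * real n + 3 > 0" "real n + 1 > 0" by simp_all
  ultimately show ?case
    using central_ratio_pos[of n]
    by (simp add: power_mult_distrib power_divide) (simp add: field_simps power2_eq_square)
qed

lemma central_ratio_bounds:
  "1 / (real n + 1/2) \<le> pi * central_ratio n ^ 2" "pi * real n * central_ratio n ^ 2 \<le> 1"
proof -
  define V where "V n = (real n + 1/2) * central_ratio n ^ 2" for n
  define U where "U n = real n * central_ratio n ^ 2" for n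
  have "V = (\<lambda>n. 1 / (2 * (\<Prod>k=1..n. (4 * real k ^ 2) / (4 * real k ^ 2 - 1))))"
    unfolding wallis_product_eq_central_ratio V_def by (simp add: fun_eq_iff field_simps)
  moreover have "(\<lambda>n. 1 / (2 * (\<Prod>k=1..n. (4 * real k ^ 2) / (4 * real k ^ 2 - 1)))) \<longlonglongrightarrow> 1 / (2 * (pi / 2))"
    by (intro tendsto_intros wallis) auto
  ultimately have V_lim: "V \<longlonglongrightarrow> 1 / pi" by simp
  have "(\<lambda>n. V n * (real n / (real n + 1/2))) \<longlonglongrightarrow> 1 / pi * 1"
    by (intro tendsto_mult V_lim) real_asymp
  moreover have "V n * (real n / (real n + 1/2)) = U n" for n
    unfolding V_def U_def by (simp add: divide_simps)
  ultimately have U_lim: "U \<longlonglongrightarrow> 1 / pi" by simp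
  have Suc_sq: "central_ratio (Suc n) ^ 2 = central_ratio n ^ 2 * ((2 * real n + 1) / (2 * real n + 2)) ^ 2" for n
    by (simp only: central_ratio_Suc power_mult_distrib)
  have "decseq V"
  proof (rule decseq_SucI)
    fix n
    \<comment> \<open>After cancellation this is \<open>(2n+1)(2n+3) \<le> (2n+2)^2\<close>.\<close>
    have "(real (Suc n) + 1/2) * ((2 * real n + 1) / (2 * real n + 2)) ^ 2 \<le> real n + 1/2"
      by (simp add: divide_simps power2_eq_square) (simp add: algebra_simps)
    then show "V (Suc n) \<le> V n"
      unfolding V_def Suc_sq
      using mult_right_mono[of _ _ "central_ratio n ^ 2"] by (fastforce simp: mult_ac)
  qed
  then have "1 / pi \<le> V n" using V_lim by (rule decseq_ge)
  then show "1 / (real n + 1/2) \<le> pi * central_ratio n ^ 2"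
    unfolding V_def by (simp add: divide_simps mult_ac)
  have "incseq U"
  proof (rule incseq_SucI)
    fix n
    \<comment> \<open>After cancellation this is \<open>4n(n+1) \<le> (2n+1)^2\<close>.\<close>
    have "real n \<le> real (Suc n) * ((2 * real n + 1) / (2 * real n + 2)) ^ 2"
      by (simp add: divide_simps power2_eq_square) (simp add: algebra_simps)
    then show "U n \<le> U (Suc n)"
      unfolding U_def Suc_sq
      using mult_right_mono[of _ _ "central_ratio n ^ 2"] by (fastforce simp: mult_ac)
  qed
  then have "U n \<le> 1 / pi" using U_lim by (rule incseq_le)
  then show "pi * real n * central_ratio n ^ 2 \<le> 1"
    unfolding U_def by (simp add: divide_simps mult_ac)
qed

lemma central_ratio_asymp:
  "(\<lambda>n. pi * real n * central_ratio n ^ 2 - 1) \<in> O(\<lambda>n. 1 / real n)"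
proof (rule bigoI[of _ 1])
  show "\<forall>\<^sub>F n in sequentially. norm (pi * real n * central_ratio n ^ 2 - 1) \<le> 1 * norm (1 / real n)"
    using eventually_gt_at_top[of 0]
  proof eventually_elim
    case (elim n)
    have "1 - 1 / real n \<le> real n * (1 / (real n + 1/2))"
      using elim by (simp add: field_simps)
    also have "\<dots> \<le> real n * (pi * central_ratio n ^ 2)"
      by (intro mult_left_mono central_ratio_bounds) simp
    finally show ?case using central_ratio_bounds(2)[of n] elim
      by (simp add: abs_if mult_ac)
  qed
qed

subsection \<open>Asymptotics of the pressure\<close>

lemma bigo_mult_minus_one:
  fixes f g h :: "'a \<Rightarrow> real"
  assumes "(\<lambda>x. f x - 1) \<in> O[F](h)" "(\<lambda>x. g x - 1) \<in> O[F](h)" "h \<in> O[F](\<lambda>_. 1)"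
  shows "(\<lambda>x. f x * g x - 1) \<in> O[F](h)"
proof -
  have "(\<lambda>x. g x - 1) \<in> O[F](\<lambda>_. 1)"
    using assms(2,3) by (rule landau_o.big.trans)
  then have "(\<lambda>x. (f x - 1) * (g x - 1)) \<in> O[F](\<lambda>x. h x * 1)"
    by (intro landau_o.big.mult assms)
  \<comment> \<open>This sum is \<open>f x * g x - 1\<close>; boundedness of \<open>h\<close> lets
    the product term be absorbed.\<close>
  then have "(\<lambda>x. (f x - 1) * (g x - 1) + ((f x - 1) + (g x - 1))) \<in> O[F](h)"
    by (intro sum_in_bigo assms) simp_all
  then show ?thesis by (simp add: algebra_simps)
qed

text \<open>Since \<open>h\<close> tends to 0, \<open>f\<close> eventually exceeds 1/2, so inverting
  at most doubles the distance to 1.\<close>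

lemma bigo_inverse_minus_one:
  fixes f h :: "'a \<Rightarrow> real"
  assumes "(\<lambda>x. f x - 1) \<in> O[F](h)" "(h \<longlongrightarrow> 0) F"
  shows "(\<lambda>x. inverse (f x) - 1) \<in> O[F](h)"
proof -
  have "h \<in> o[F](\<lambda>_. 1)"
    using assms(2) by (intro smalloI_tendsto) simp_all
  with assms(1) have "(\<lambda>x. f x - 1) \<in> o[F](\<lambda>_. 1)"
    by (rule landau_o.big_small_trans)
  then have "((\<lambda>x. f x - 1) \<longlongrightarrow> 0) F"
    using smalloD_tendsto by fastforce
  then have "(f \<longlongrightarrow> 1) F" by (rule LIM_zero_cancel)
  then have "\<forall>\<^sub>F x in F. f x > 1/2" by (rule order_tendstoD) simp
  then have "\<forall>\<^sub>F x in F. norm (inverse (f x) - 1) \<le> 2 * norm (f x - 1)"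
  proof eventually_elim
    case (elim x)
    have "inverse (f x) - 1 = - inverse (f x) * (f x - 1)" using elim by (simp add: field_simps)
    then have "norm (inverse (f x) - 1) = inverse (f x) * norm (f x - 1)"
      using elim by (simp add: abs_mult)
    also have "\<dots> \<le> 2 * norm (f x - 1)"
      using elim by (intro mult_right_mono) (auto simp: field_simps)
    finally show ?case .
  qed
  then have "(\<lambda>x. inverse (f x) - 1) \<in> O[F](\<lambda>x. f x - 1)" by (rule bigoI)
  then show ?thesis using assms(1) by (rule landau_o.big.trans)
qed

text \<open>From \<open>f - 1 = (sqrt f + 1)(sqrt f - 1)\<close>, the root is at least as close to 1
  as \<open>f\<close>.\<close>

lemma bigo_sqrt_minus_one:
  fixes f h :: "'a \<Rightarrow> real"
  assumes "(\<lambda>x. f x - 1) \<in> O[F](h)" "\<forall>\<^sub>F x in F. 0 \<le> f x"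
  shows "(\<lambda>x. sqrt (f x) - 1) \<in> O[F](h)"
proof -
  have "\<forall>\<^sub>F x in F. norm (sqrt (f x) - 1) \<le> 1 * norm (f x - 1)"
    using assms(2)
  proof eventually_elim
    case (elim x)
    have "f x - 1 = (sqrt (f x) + 1) * (sqrt (f x) - 1)"
      using elim by (simp add: algebra_simps)
    then have "\<bar>f x - 1\<bar> = (sqrt (f x) + 1) * \<bar>sqrt (f x) - 1\<bar>"
      using elim by (simp add: abs_mult)
    also have "\<dots> \<ge> 1 * \<bar>sqrt (f x) - 1\<bar>"
      using elim by (intro mult_right_mono) auto
    finally show ?case by simp
  qed
  then have "(\<lambda>x. sqrt (f x) - 1) \<in> O[F](\<lambda>x. f x - 1)" by (rule bigoI)
  then show ?thesis using assms(1) by (rule landau_o.big.trans)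
qed

text \<open>Here \<open>r\<close> is the fraction of paths through the point. The condition
  \<open>r < 1\<close> makes the logarithm genuine and excludes \<open>N = 0\<close>, where
  \<open>r = 1\<close>.\<close>

lemma pressure_eq:
  fixes n N :: nat
  defines "r \<equiv> central_ratio N * central_ratio (n - N) / (real (N + 1) * central_ratio n)"
  assumes "N \<le> n" "r < 1"
  shows "pressure (2 * n) (2 * N) = ln (1 - r)"
proof -
  define T where "T = real (card (positive_paths (2 * n)))"
  have T: "T = central_ratio n * 4 ^ n" "T > 0"
    by (simp_all add: T_def card_positive_paths_even central_ratio_def)
  have D: "real (card (endpoint_paths (2 * N) 0)) = central_ratio N * 4 ^ N / real (N + 1)"
    using card_Dyck_paths[of N] by (simp only: central_ratio_def eq_divide_eq) (simp add: mult_ac)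
  have T': "real (card (positive_paths (2 * n - 2 * N))) = central_ratio (n - N) * 4 ^ (n - N)"
    using card_positive_paths_even[of "n - N"] by (simp add: central_ratio_def diff_mult_distrib2)
  have pow: "(4::real) ^ n = 4 ^ N * 4 ^ (n - N)"
    using assms(2) by (simp flip: power_add)
  have "real (card (endpoint_paths (2 * N) 0)) * real (card (positive_paths (2 * n - 2 * N))) = r * T"
    unfolding D T' T(1) r_def pow using central_ratio_pos[of n] by (simp add: divide_simps)
  moreover have "real (card {p \<in> positive_paths (2 * n). (int (2 * N), 0) \<notin> vertices p}) +
      real (card (endpoint_paths (2 * N) 0)) * real (card (positive_paths (2 * n - 2 * N))) = T"
    unfolding T_def of_nat_mult[symmetric] of_nat_add[symmetric] of_nat_eq_iff
    using assms(2) by (intro card_avoiding_paths) simp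
  ultimately have "real (card {p \<in> positive_paths (2 * n). (int (2 * N), 0) \<notin> vertices p}) =
      (1 - r) * T"
    by (simp add: algebra_simps)
  then show ?thesis
    using assms(3) T(2) unfolding pressure_def T_def[symmetric] by (simp add: ln_mult)
qed

text \<open>Once \<open>k * n \<ge> 2\<close>, \<open>x n\<close> is at least
  \<open>k * n / 2\<close>. It serves for \<open>N\<close> and \<open>N + 1\<close> with
  \<open>k = a\<close>, and for \<open>n - N\<close> with \<open>k = 1 - a\<close>, where rounding
  costs at most 1.\<close>

lemma linear_over_near_linear_asymp:
  fixes x :: "nat \<Rightarrow> real"
  assumes "0 < k" "\<forall>\<^sub>F n in sequentially. \<bar>x n - k * real n\<bar> \<le> 1"
  shows "(\<lambda>n. 1 / x n) \<in> O(\<lambda>n. 1 / real n)"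
    and "(\<lambda>n. k * real n / x n - 1) \<in> O(\<lambda>n. 1 / real n)"
    and "filterlim x at_top sequentially"
proof -
  have "\<forall>\<^sub>F n in sequentially. 2 \<le> k * real n"
    using assms(1) by real_asymp
  then have *: "\<forall>\<^sub>F n in sequentially. x n \<ge> k * real n / 2 \<and> real n > 0 \<and> \<bar>x n - k * real n\<bar> \<le> 1"
    using assms(2) eventually_gt_at_top[of 0] by eventually_elim auto
  have ineq: "1 / x n \<le> 2 / k * (1 / real n)" "x n > 0" if "x n \<ge> k * real n / 2" "real n > 0" for n
  proof -
    have "0 < k * real n / 2" using that assms(1) by simp
    then show "x n > 0" using that by linarith
    have "1 / x n \<le> 1 / (k * real n / 2)"
      using \<open>0 < k * real n / 2\<close> that by (intro divide_left_mono) auto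
    then show "1 / x n \<le> 2 / k * (1 / real n)" by simp
  qed
  show "(\<lambda>n. 1 / x n) \<in> O(\<lambda>n. 1 / real n)"
  proof (rule bigoI)
    show "\<forall>\<^sub>F n in sequentially. norm (1 / x n) \<le> 2 / k * norm (1 / real n)"
      using *
    proof eventually_elim
      case (elim n)
      then show ?case using ineq[of n] by simp
    qed
  qed
  show "(\<lambda>n. k * real n / x n - 1) \<in> O(\<lambda>n. 1 / real n)"
  proof (rule bigoI)
    show "\<forall>\<^sub>F n in sequentially. norm (k * real n / x n - 1) \<le> 2 / k * norm (1 / real n)"
      using *
    proof eventually_elim
      case (elim n)
      then have "x n > 0" and le: "1 / x n \<le> 2 / k * (1 / real n)" using ineq by auto
      then have "k * real n / x n - 1 = (k * real n - x n) / x n" by (simp add: field_simps)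
      then have "norm (k * real n / x n - 1) = \<bar>x n - k * real n\<bar> / x n"
        using \<open>x n > 0\<close> by (simp add: abs_minus_commute)
      also have "\<dots> \<le> 1 / x n" using elim \<open>x n > 0\<close> by (intro divide_right_mono) auto
      finally show ?case using le by simp
    qed
  qed
  have "filterlim (\<lambda>n. k * real n / 2) at_top sequentially"
    using assms(1) by real_asymp
  then show "filterlim x at_top sequentially"
    by (rule filterlim_at_top_mono) (use * in eventually_elim, auto)
qed

text \<open>Two errors are added: \<open>r - L\<close>, obtained by comparing squares so that only
  \<open>central_ratio\<close> squared enters, and the error of \<open>ln (1 - r)\<close> against
  \<open>-r\<close>.\<close>

lemma pressure_asymptotics:
  fixes a :: real
  assumes a: "0 < a" "a < 1"
  defines "K \<equiv> 1 / sqrt (pi * a ^ 3 * (1 - a))"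
  shows "(\<lambda>n. pressure (2 * n) (2 * nat \<lfloor>a * real n\<rfloor>) + K * real n powr (-3/2))
           \<in> O(\<lambda>n. real n powr (-5/2))"
proof -
  define N where "N n = nat \<lfloor>a * real n\<rfloor>" for n
  define r where "r n = central_ratio (N n) * central_ratio (n - N n) /
    (real (N n + 1) * central_ratio n)" for n
  define L where "L n = K * real n powr (-3/2)" for n
  define b where "b n = pi * real n * central_ratio n ^ 2" for n
  let ?h = "\<lambda>n. 1 / real n"

  have N: "real (N n) \<le> a * real n" "a * real n < real (N n) + 1" for n
    using a by (auto simp: N_def)
  have N_le: "N n \<le> n" for n
  proof -
    have "a * real n \<le> 1 * real n" using a by (intro mult_right_mono) auto
    with N(1)[of n] show ?thesis by linarith
  qed
  have near: "\<bar>real (N n) - a * real n\<bar> \<le> 1" "\<bar>real (N n + 1) - a * real n\<bar> \<le> 1"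
    "\<bar>real (n - N n) - (1 - a) * real n\<bar> \<le> 1" for n
    using N[of n] N_le[of n] by (auto simp: algebra_simps of_nat_diff)
  note asymp_N = linear_over_near_linear_asymp[OF a(1) always_eventually[OF allI[OF near(1)]]]
  note asymp_N1 = linear_over_near_linear_asymp[OF a(1) always_eventually[OF allI[OF near(2)]]]
  have "0 < 1 - a" using a by simp
  note asymp_M = linear_over_near_linear_asymp[OF this always_eventually[OF allI[OF near(3)]]]

  have b: "(\<lambda>n. b n - 1) \<in> O(?h)"
    using central_ratio_asymp by (simp add: b_def)
  \<comment> \<open>The estimate at index \<open>m n\<close> has error \<open>O(1 / m n)\<close>,
    which is \<open>O(1/n)\<close> when \<open>m\<close> grows linearly.\<close>
  have b_comp: "(\<lambda>n. b (m n) - 1) \<in> O(?h)"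
    if "filterlim (\<lambda>n. real (m n)) at_top sequentially" "(\<lambda>n. 1 / real (m n)) \<in> O(?h)" for m
  proof -
    have "filterlim m at_top sequentially"
      using that(1) by (simp add: filterlim_sequentially_iff_filterlim_real)
    from landau_o.big.compose[OF b this] that(2) show ?thesis
      by (rule landau_o.big.trans)
  qed
  have h: "?h \<in> O(\<lambda>_. 1)" "?h \<longlonglongrightarrow> 0" by real_asymp+
  \<comment> \<open>The exact value of \<open>(r n / L n)\<^sup>2\<close>, arranged as a product of factors that are each
    \<open>1 + O(1/n)\<close>.\<close>
  define q where "q n = b (N n) * b (n - N n) * inverse (b n) * (a * real n / real (N n)) *
    ((1 - a) * real n / real (n - N n)) * (a * real n / real (N n + 1)) *
    (a * real n / real (N n + 1))" for n
  have q: "(\<lambda>n. q n - 1) \<in> O(?h)"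
    unfolding q_def
    by (intro bigo_mult_minus_one bigo_inverse_minus_one b_comp b h
        asymp_N asymp_M asymp_N1)
  have "q n \<ge> 0" for n
    using a by (auto simp: q_def b_def intro!: mult_nonneg_nonneg divide_nonneg_nonneg)
  then have sqrt_q: "(\<lambda>n. sqrt (q n) - 1) \<in> O(?h)"
    using q by (intro bigo_sqrt_minus_one) auto

  have K: "K > 0" "K ^ 2 = 1 / (pi * a ^ 3 * (1 - a))"
    using a by (auto simp: K_def power_divide)
  \<comment> \<open>This keeps the denominators in \<open>q\<close> away from the default value of
    division by zero.\<close>
  have "\<forall>\<^sub>F n in sequentially. 1 \<le> real (N n)" "\<forall>\<^sub>F n in sequentially. 1 \<le> real (n - N n)"
    using asymp_N(3) asymp_M(3) unfolding filterlim_at_top by blast+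
  then have "\<forall>\<^sub>F n in sequentially. L n * (sqrt (q n) - 1) = r n - L n"
    using eventually_gt_at_top[of 0]
  proof eventually_elim
    case (elim n)
    have pos: "central_ratio n > 0" "r n > 0" "L n > 0"
      using K(1) elim by (auto simp: central_ratio_pos r_def L_def)
    have "L n ^ 2 = K ^ 2 / real n ^ 3"
    proof -
      have "(real n powr (-3/2)) ^ 2 = real n powr (-3)"
        using elim by (simp add: powr_power)
      also have "\<dots> = 1 / real n ^ 3"
        using elim by (simp add: powr_minus_divide powr_numeral)
      finally show ?thesis by (simp add: L_def power_mult_distrib)
    qed
    then have "L n ^ 2 * q n = r n ^ 2"
      unfolding K(2) q_def r_def b_def using elim a pos(1)
      by (simp add: divide_simps power2_eq_square power3_eq_cube, auto simp: mult_ac)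
    then have "sqrt (L n ^ 2 * q n) = sqrt (r n ^ 2)" by simp
    then have "L n * sqrt (q n) = r n"
      using pos by (simp add: real_sqrt_mult)
    then show ?case by (simp add: algebra_simps)
  qed
  then have "(\<lambda>n. r n - L n) \<in> O(\<lambda>n. real n powr (-5/2)) \<longleftrightarrow>
      (\<lambda>n. L n * (sqrt (q n) - 1)) \<in> O(\<lambda>n. real n powr (-5/2))"
    by (intro landau_o.big.in_cong) (auto elim: eventually_mono)
  moreover have "(\<lambda>n. L n * (sqrt (q n) - 1)) \<in> O(\<lambda>n. real n powr (-3/2) * ?h n)"
    using sqrt_q by (intro landau_o.big.mult) (auto simp: L_def)
  moreover have "(\<lambda>n. real n powr (-3/2) * ?h n) \<in> O(\<lambda>n. real n powr (-5/2))"
    by real_asymp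
  ultimately have rL: "(\<lambda>n. r n - L n) \<in> O(\<lambda>n. real n powr (-5/2))"
    using landau_o.big.trans by blast

  have "(\<lambda>n. real n powr (-5/2)) \<in> O(\<lambda>n. real n powr (-3/2))" by real_asymp
  with rL have "(\<lambda>n. r n - L n) \<in> O(\<lambda>n. real n powr (-3/2))"
    by (rule landau_o.big.trans)
  moreover have "L \<in> O(\<lambda>n. real n powr (-3/2))" by (simp add: L_def[abs_def])
  ultimately have "(\<lambda>n. (r n - L n) + L n) \<in> O(\<lambda>n. real n powr (-3/2))"
    by (rule sum_in_bigo)
  then have r: "r \<in> O(\<lambda>n. real n powr (-3/2))" by simp
  have "(\<lambda>n. real n powr (-3/2)) \<in> o(\<lambda>_. 1)" by real_asymp
  with r have "r \<in> o(\<lambda>_. 1)" by (rule landau_o.big_small_trans)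
  then have "r \<longlonglongrightarrow> 0" by (auto dest: smalloD_tendsto)
  \<comment> \<open>The bound 1/2 gives both \<open>r n < 1\<close> and the range in which the
    quadratic bound for \<open>ln (1 + x) - x\<close> holds.\<close>
  then have small: "\<forall>\<^sub>F n in sequentially. r n < 1/2" by (rule order_tendstoD) simp
  have r_nonneg: "r n \<ge> 0" for n
    unfolding r_def using central_ratio_pos by (intro divide_nonneg_nonneg mult_nonneg_nonneg)
      (auto intro: less_imp_le)

  have "(\<lambda>n. pressure (2 * n) (2 * N n) + r n) \<in> O(\<lambda>n. r n ^ 2)"
  proof (rule bigoI)
    show "\<forall>\<^sub>F n in sequentially. norm (pressure (2 * n) (2 * N n) + r n) \<le> 2 * norm (r n ^ 2)"
      using small
    proof eventually_elim
      case (elim n)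
      then have "r n < 1" by simp
      then have "pressure (2 * n) (2 * N n) = ln (1 - r n)"
        using pressure_eq[OF N_le[of n]] unfolding r_def by blast
      then show ?case
        using abs_ln_one_plus_x_minus_x_bound[of "- r n"] elim r_nonneg[of n] by simp
    qed
  qed
  also have "(\<lambda>n. r n ^ 2) \<in> O(\<lambda>n. (real n powr (-3/2)) ^ 2)"
    using r by (rule landau_o.big_power)
  also have "(\<lambda>n. (real n powr (-3/2)) ^ 2) \<in> O(\<lambda>n. real n powr (-5/2))" by real_asymp
  finally have "(\<lambda>n. (pressure (2 * n) (2 * N n) + r n) - (r n - L n)) \<in> O(\<lambda>n. real n powr (-5/2))"
    using rL by (rule sum_in_bigo)
  then show ?thesis by (simp add: L_def N_def)
qed

theorem mainTheorem3:
  fixes a :: real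
  assumes "0 < a" and "a < 1"
  shows "(\<lambda>n::nat. pressure (2 * n) (2 * nat \<lfloor>a * real n\<rfloor>)
            - (- (1 / sqrt (pi * real n ^ 3 * a ^ 3 * (1 - a)))))
           \<in> O(\<lambda>n. real n powr (- (5 / 2)))
       \<and> (\<lambda>n::nat. real n powr (3 / 2) * pressure (2 * n) (2 * nat \<lfloor>a * real n\<rfloor>))
           \<longlonglongrightarrow> - (1 / sqrt (pi * a ^ 3 * (1 - a)))"
proof
  define P where "P n = pressure (2 * n) (2 * nat \<lfloor>a * real n\<rfloor>)" for n
  define K where "K = 1 / sqrt (pi * a ^ 3 * (1 - a))"
  have main: "(\<lambda>n. P n + K * real n powr (-3/2)) \<in> O(\<lambda>n. real n powr (-5/2))"
    unfolding P_def K_def by (rule pressure_asymptotics[OF assms])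

  \<comment> \<open>Valid for every \<open>n\<close>: at \<open>n = 0\<close> both sides are 0 by
    convention.\<close>
  have "1 / sqrt (pi * real n ^ 3 * a ^ 3 * (1 - a)) = K * real n powr (-3/2)" for n
  proof (cases "n = 0")
    case False
    have "sqrt (real n ^ 3) = (real n powr 3) powr (1/2)"
      by (simp add: powr_half_sqrt powr_numeral)
    also have "\<dots> = real n powr (3/2)"
      by (simp add: powr_powr del: powr_numeral)
    finally have "sqrt (real n ^ 3) = real n powr (3/2)" .
    then have "sqrt (pi * real n ^ 3 * a ^ 3 * (1 - a)) = sqrt (pi * a ^ 3 * (1 - a)) * real n powr (3/2)"
      by (simp add: real_sqrt_mult mult_ac)
    then show ?thesis
      using False by (simp add: K_def powr_minus_divide)
  qed simp
  with main show "(\<lambda>n. pressure (2 * n) (2 * nat \<lfloor>a * real n\<rfloor>)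
        - (- (1 / sqrt (pi * real n ^ 3 * a ^ 3 * (1 - a))))) \<in> O(\<lambda>n. real n powr (- (5 / 2)))"
    by (simp add: P_def)

  \<comment> \<open>Scaling by \<open>n powr (3/2)\<close> leaves an error \<open>O(1/n)\<close>, so
    the limit follows from the expansion.\<close>
  have "(\<lambda>n. real n powr (3/2) * (P n + K * real n powr (-3/2))) \<in>
      O(\<lambda>n. real n powr (3/2) * real n powr (-5/2))"
    using main by (intro landau_o.big.mult) auto
  also have "(\<lambda>n. real n powr (3/2) * real n powr (-5/2)) \<in> o(\<lambda>_. 1)" by real_asymp
  finally have "(\<lambda>n. real n powr (3/2) * (P n + K * real n powr (-3/2))) \<longlonglongrightarrow> 0"
    by (auto dest: smalloD_tendsto)
  then have "(\<lambda>n. real n powr (3/2) * (P n + K * real n powr (-3/2)) - K) \<longlonglongrightarrow> 0 - K"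
    by (intro tendsto_intros)
  \<comment> \<open>Only eventually, since the two powers multiply to 0 instead of 1 at
    \<open>n = 0\<close>.\<close>
  moreover have "\<forall>\<^sub>F n in sequentially.
      real n powr (3/2) * (P n + K * real n powr (-3/2)) - K = real n powr (3/2) * P n"
    using eventually_gt_at_top[of 0]
  proof eventually_elim
    case (elim n)
    have "real n powr (3/2) * real n powr (-3/2) = 1"
      using elim by (simp flip: powr_add)
    then show ?case by (simp add: algebra_simps)
  qed
  ultimately have "(\<lambda>n. real n powr (3/2) * P n) \<longlonglongrightarrow> 0 - K"
    by (rule Lim_transform_eventually)
  then show "(\<lambda>n. real n powr (3 / 2) * pressure (2 * n) (2 * nat \<lfloor>a * real n\<rfloor>))
      \<longlonglongrightarrow> - (1 / sqrt (pi * a ^ 3 * (1 - a)))"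
    by (simp add: P_def K_def)
qed

end
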